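(* Let $R$ be a ring and let $I$ be an N-pure ideal of $R$. Then $$\sqrt{I}=\bigcap_{\mathfrak{m}\in V(I)\cap \operatorname{Max}(R)} \sqrt{\operatorname{Ker}\pi_{\mathfrak{m}}}.$$
   Context: All rings are commutative with identity. $N(R)$ denotes the nilradical of $R$. An ideal $I$ of $R$ is called N-pure if for every $a\in I$ there exists $b\in I$ such that $a(1-b)\in N(R)$. $\operatorname{Max}(R)$ is the set of maximal ideals of $R$ and $V(I)$ is the set of prime ideals of $R$ containing $I$. For a prime ideal $\mathfrak{p}$ of $R$, $\pi_{\mathfrak{p}}:R\to R_{\mathfrak{p}}=(R\setminus\mathfrak{p})^{-1}R$ denotes the natural localization homomorphism. $\sqrt{\cdot}$ denotes the radical of an ideal. The intersection over an empty family of ideals is $R$. *)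

theory Defs
  imports "HOL-Algebra.QuotRing"
begin

definition ideal_radical :: "('a, 'b) ring_scheme \<Rightarrow> 'a set \<Rightarrow> 'a set" where
  "ideal_radical R J = {a \<in> carrier R. \<exists>n::nat. 0 < n \<and> a [^]\<^bsub>R\<^esub> n \<in> J}"

definition nilradical :: "('a, 'b) ring_scheme \<Rightarrow> 'a set" where
  "nilradical R = ideal_radical R {\<zero>\<^bsub>R\<^esub>}"

definition N_pure_ideal :: "('a, 'b) ring_scheme \<Rightarrow> 'a set \<Rightarrow> bool" where
  "N_pure_ideal R I \<longleftrightarrow> ideal I R \<and>
    (\<forall>a\<in>I. \<exists>b\<in>I. a \<otimes>\<^bsub>R\<^esub> (\<one>\<^bsub>R\<^esub> \<ominus>\<^bsub>R\<^esub> b) \<in> nilradical R)"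

definition Max_spec :: "('a, 'b) ring_scheme \<Rightarrow> 'a set set" where
  "Max_spec R = {\<mm>. maximalideal \<mm> R}"

definition V_ideal :: "('a, 'b) ring_scheme \<Rightarrow> 'a set \<Rightarrow> 'a set set" where
  "V_ideal R I = {\<pp>. primeideal \<pp> R \<and> I \<subseteq> \<pp>}"

text \<open>The ring of fractions \<open>S\<inverse>R\<close>: a fraction \<open>a/s\<close> is the class of the pair \<open>(a, s)\<close> under
  \<open>a/s = b/t \<longleftrightarrow> (\<exists>u\<in>S. u (a t - b s) = 0)\<close>. Sums and products of classes are written as unions
  over all representatives; since the operations respect the relation, such a union is a
  single class (lemmas \<open>fraction_add\<close> and \<open>fraction_mult\<close> below).\<close>

definition fraction_rel :: "('a, 'b) ring_scheme \<Rightarrow> 'a set \<Rightarrow> (('a \<times> 'a) \<times> ('a \<times> 'a)) set" where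
  "fraction_rel R S = {((a, s), (b, t)).
     a \<in> carrier R \<and> s \<in> S \<and> b \<in> carrier R \<and> t \<in> S \<and>
     (\<exists>u\<in>S. u \<otimes>\<^bsub>R\<^esub> (a \<otimes>\<^bsub>R\<^esub> t \<ominus>\<^bsub>R\<^esub> b \<otimes>\<^bsub>R\<^esub> s) = \<zero>\<^bsub>R\<^esub>)}"

definition fraction :: "('a, 'b) ring_scheme \<Rightarrow> 'a set \<Rightarrow> 'a \<Rightarrow> 'a \<Rightarrow> ('a \<times> 'a) set" where
  "fraction R S a s = fraction_rel R S `` {(a, s)}"

definition ring_of_fractions :: "('a, 'b) ring_scheme \<Rightarrow> 'a set \<Rightarrow> ('a \<times> 'a) set ring" where
  "ring_of_fractions R S =
    \<lparr>carrier = (carrier R \<times> S) // fraction_rel R S,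
     mult = (\<lambda>A B. \<Union>(a, s)\<in>A. \<Union>(b, t)\<in>B. fraction R S (a \<otimes>\<^bsub>R\<^esub> b) (s \<otimes>\<^bsub>R\<^esub> t)),
     one = fraction R S \<one>\<^bsub>R\<^esub> \<one>\<^bsub>R\<^esub>,
     zero = fraction R S \<zero>\<^bsub>R\<^esub> \<one>\<^bsub>R\<^esub>,
     add = (\<lambda>A B. \<Union>(a, s)\<in>A. \<Union>(b, t)\<in>B.
              fraction R S (a \<otimes>\<^bsub>R\<^esub> t \<oplus>\<^bsub>R\<^esub> b \<otimes>\<^bsub>R\<^esub> s) (s \<otimes>\<^bsub>R\<^esub> t))\<rparr>"

definition localization_at :: "('a, 'b) ring_scheme \<Rightarrow> 'a set \<Rightarrow> ('a \<times> 'a) set ring" where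
  "localization_at R \<pp> = ring_of_fractions R (carrier R - \<pp>)"

definition localization_map :: "('a, 'b) ring_scheme \<Rightarrow> 'a set \<Rightarrow> 'a \<Rightarrow> ('a \<times> 'a) set" where
  "localization_map R \<pp> a = fraction R (carrier R - \<pp>) a \<one>\<^bsub>R\<^esub>"

locale fractions = cring R + submonoid S R for R (structure) and S
begin

lemma S_carrier: "s \<in> S \<Longrightarrow> s \<in> carrier R"
  by (rule mem_carrier)

lemma fraction_rel_iff:
  "((a, s), (b, t)) \<in> fraction_rel R S \<longleftrightarrow>
     a \<in> carrier R \<and> s \<in> S \<and> b \<in> carrier R \<and> t \<in> S \<and>
     (\<exists>u\<in>S. u \<otimes> (a \<otimes> t) = u \<otimes> (b \<otimes> s))"
proof -
  have "u \<otimes> (a \<otimes> t \<ominus> b \<otimes> s) = \<zero> \<longleftrightarrow> u \<otimes> (a \<otimes> t) = u \<otimes> (b \<otimes> s)"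
    if "u \<in> carrier R" "a \<in> carrier R" "s \<in> carrier R" "b \<in> carrier R" "t \<in> carrier R" for u
  proof -
    have "u \<otimes> (a \<otimes> t \<ominus> b \<otimes> s) = u \<otimes> (a \<otimes> t) \<ominus> u \<otimes> (b \<otimes> s)"
      using that by (simp add: a_minus_def r_distr r_minus)
    moreover have "x \<ominus> y = \<zero> \<longleftrightarrow> x = y" if "x \<in> carrier R" "y \<in> carrier R" for x y
    proof -
      have "x = (x \<ominus> y) \<oplus> y"
        using that by (simp add: a_minus_def a_assoc l_neg)
      then show ?thesis
        using that by (metis l_zero a_minus_def r_neg)
    qed
    ultimately show ?thesis
      using that by simp
  qed
  then show ?thesis
    unfolding fraction_rel_def using S_carrier by auto
qed

lemma fraction_relI:
  assumes "a \<in> carrier R" "s \<in> S" "b \<in> carrier R" "t \<in> S" "u \<in> S"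
    "u \<otimes> (a \<otimes> t) = u \<otimes> (b \<otimes> s)"
  shows "((a, s), (b, t)) \<in> fraction_rel R S"
  using assms unfolding fraction_rel_iff by blast

lemma equiv_fraction_rel: "equiv (carrier R \<times> S) (fraction_rel R S)"
proof (rule equivI)
  show "fraction_rel R S \<subseteq> (carrier R \<times> S) \<times> (carrier R \<times> S)"
    unfolding fraction_rel_def by auto
  show "refl_on (carrier R \<times> S) (fraction_rel R S)"
    unfolding refl_on_def by (auto simp: fraction_rel_iff)
  show "sym (fraction_rel R S)"
    unfolding sym_def by (auto simp: fraction_rel_iff) metis
  show "trans (fraction_rel R S)"
  proof (rule transI, clarify)
    fix a s b t c w
    assume "((a, s), (b, t)) \<in> fraction_rel R S" and "((b, t), (c, w)) \<in> fraction_rel R S"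
    then obtain u v where uv: "u \<in> S" "v \<in> S"
      and u: "u \<otimes> (a \<otimes> t) = u \<otimes> (b \<otimes> s)" and v: "v \<otimes> (b \<otimes> w) = v \<otimes> (c \<otimes> t)"
      and S: "s \<in> S" "t \<in> S" "w \<in> S"
      and C: "a \<in> carrier R" "b \<in> carrier R" "c \<in> carrier R"
      unfolding fraction_rel_iff by auto
    note C = C uv[THEN S_carrier] S[THEN S_carrier]
    have "(u \<otimes> v \<otimes> t) \<otimes> (a \<otimes> w) = (u \<otimes> (a \<otimes> t)) \<otimes> (v \<otimes> w)"
      using C by (simp add: m_ac)
    also have "\<dots> = (u \<otimes> s) \<otimes> (v \<otimes> (b \<otimes> w))"
      unfolding u using C by (simp add: m_ac)
    also have "\<dots> = (u \<otimes> v \<otimes> t) \<otimes> (c \<otimes> s)"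
      unfolding v using C by (simp add: m_ac)
    finally show "((a, s), (c, w)) \<in> fraction_rel R S"
      using uv S C by (intro fraction_relI[where u = "u \<otimes> v \<otimes> t"]) auto
  qed
qed

lemma fraction_eq:
  assumes "a \<in> carrier R" "s \<in> S" "b \<in> carrier R" "t \<in> S"
  shows "fraction R S a s = fraction R S b t \<longleftrightarrow> ((a, s), (b, t)) \<in> fraction_rel R S"
  unfolding fraction_def using assms by (intro eq_equiv_class_iff[OF equiv_fraction_rel]) auto

lemma fraction_self: "a \<in> carrier R \<Longrightarrow> s \<in> S \<Longrightarrow> (a, s) \<in> fraction R S a s"
  unfolding fraction_def by (rule equiv_class_self[OF equiv_fraction_rel]) simp

lemma fraction_closed [simp]:
  "a \<in> carrier R \<Longrightarrow> s \<in> S \<Longrightarrow> fraction R S a s \<in> carrier (ring_of_fractions R S)"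
  unfolding ring_of_fractions_def fraction_def by (auto intro: quotientI)

lemma fraction_cases:
  assumes "A \<in> carrier (ring_of_fractions R S)"
  obtains a s where "a \<in> carrier R" "s \<in> S" "A = fraction R S a s"
  using assms unfolding ring_of_fractions_def fraction_def by (auto elim!: quotientE)

lemma fraction_mult_cong:
  assumes "((a, s), (a', s')) \<in> fraction_rel R S" "((b, t), (b', t')) \<in> fraction_rel R S"
  shows "((a \<otimes> b, s \<otimes> t), (a' \<otimes> b', s' \<otimes> t')) \<in> fraction_rel R S"
proof -
  from assms obtain u v where uv: "u \<in> S" "v \<in> S"
    and u: "u \<otimes> (a \<otimes> s') = u \<otimes> (a' \<otimes> s)" and v: "v \<otimes> (b \<otimes> t') = v \<otimes> (b' \<otimes> t)"
    and S: "s \<in> S" "t \<in> S" "s' \<in> S" "t' \<in> S"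
    and C: "a \<in> carrier R" "b \<in> carrier R" "a' \<in> carrier R" "b' \<in> carrier R"
    unfolding fraction_rel_iff by auto
  note C = C uv[THEN S_carrier] S[THEN S_carrier]
  have "(u \<otimes> v) \<otimes> ((a \<otimes> b) \<otimes> (s' \<otimes> t')) = (u \<otimes> (a \<otimes> s')) \<otimes> (v \<otimes> (b \<otimes> t'))"
    using C by (simp add: m_ac)
  also have "\<dots> = (u \<otimes> v) \<otimes> ((a' \<otimes> b') \<otimes> (s \<otimes> t))"
    unfolding u v using C by (simp add: m_ac)
  finally show ?thesis
    using uv S C by (intro fraction_relI[where u = "u \<otimes> v"]) auto
qed

lemma fraction_add_cong:
  assumes "((a, s), (a', s')) \<in> fraction_rel R S" "((b, t), (b', t')) \<in> fraction_rel R S"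
  shows "((a \<otimes> t \<oplus> b \<otimes> s, s \<otimes> t), (a' \<otimes> t' \<oplus> b' \<otimes> s', s' \<otimes> t')) \<in> fraction_rel R S"
proof -
  from assms obtain u v where uv: "u \<in> S" "v \<in> S"
    and u: "u \<otimes> (a \<otimes> s') = u \<otimes> (a' \<otimes> s)" and v: "v \<otimes> (b \<otimes> t') = v \<otimes> (b' \<otimes> t)"
    and S: "s \<in> S" "t \<in> S" "s' \<in> S" "t' \<in> S"
    and C: "a \<in> carrier R" "b \<in> carrier R" "a' \<in> carrier R" "b' \<in> carrier R"
    unfolding fraction_rel_iff by auto
  note C = C uv[THEN S_carrier] S[THEN S_carrier]
  have "(u \<otimes> v) \<otimes> ((a \<otimes> t \<oplus> b \<otimes> s) \<otimes> (s' \<otimes> t')) =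
      (u \<otimes> (a \<otimes> s')) \<otimes> (v \<otimes> t \<otimes> t') \<oplus> (v \<otimes> (b \<otimes> t')) \<otimes> (u \<otimes> s \<otimes> s')"
    using C by (simp add: l_distr r_distr m_ac)
  also have "\<dots> = (u \<otimes> v) \<otimes> ((a' \<otimes> t' \<oplus> b' \<otimes> s') \<otimes> (s \<otimes> t))"
    unfolding u v using C by (simp add: l_distr r_distr m_ac)
  finally show ?thesis
    using uv S C by (intro fraction_relI[where u = "u \<otimes> v"]) auto
qed

lemma fraction_mult:
  assumes "a \<in> carrier R" "s \<in> S" "b \<in> carrier R" "t \<in> S"
  shows "fraction R S a s \<otimes>\<^bsub>ring_of_fractions R S\<^esub> fraction R S b t = fraction R S (a \<otimes> b) (s \<otimes> t)"
proof -
  have "fraction R S (a' \<otimes> b') (s' \<otimes> t') = fraction R S (a \<otimes> b) (s \<otimes> t)"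
    if "(a', s') \<in> fraction R S a s" "(b', t') \<in> fraction R S b t" for a' s' b' t'
    using that fraction_mult_cong[of a s a' s' b t b' t']
    unfolding fraction_def by (intro equiv_class_eq[OF equiv_fraction_rel, symmetric]) simp
  then have "(\<Union>(a', s')\<in>fraction R S a s. \<Union>(b', t')\<in>fraction R S b t.
      fraction R S (a' \<otimes> b') (s' \<otimes> t')) = fraction R S (a \<otimes> b) (s \<otimes> t)"
    using fraction_self[OF assms(3,4)]
    by (intro UN_constant_eq[OF fraction_self[OF assms(1,2)]]) (auto intro!: UN_constant_eq[OF fraction_self[OF assms(3,4)]])
  then show ?thesis
    unfolding ring_of_fractions_def by simp
qed

lemma fraction_add:
  assumes "a \<in> carrier R" "s \<in> S" "b \<in> carrier R" "t \<in> S"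
  shows "fraction R S a s \<oplus>\<^bsub>ring_of_fractions R S\<^esub> fraction R S b t =
    fraction R S (a \<otimes> t \<oplus> b \<otimes> s) (s \<otimes> t)"
proof -
  have "fraction R S (a' \<otimes> t' \<oplus> b' \<otimes> s') (s' \<otimes> t') = fraction R S (a \<otimes> t \<oplus> b \<otimes> s) (s \<otimes> t)"
    if "(a', s') \<in> fraction R S a s" "(b', t') \<in> fraction R S b t" for a' s' b' t'
    using that fraction_add_cong[of a s a' s' b t b' t']
    unfolding fraction_def by (intro equiv_class_eq[OF equiv_fraction_rel, symmetric]) simp
  then have "(\<Union>(a', s')\<in>fraction R S a s. \<Union>(b', t')\<in>fraction R S b t.
      fraction R S (a' \<otimes> t' \<oplus> b' \<otimes> s') (s' \<otimes> t')) = fraction R S (a \<otimes> t \<oplus> b \<otimes> s) (s \<otimes> t)"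
    using fraction_self[OF assms(3,4)]
    by (intro UN_constant_eq[OF fraction_self[OF assms(1,2)]]) (auto intro!: UN_constant_eq[OF fraction_self[OF assms(3,4)]])
  then show ?thesis
    unfolding ring_of_fractions_def by simp
qed

lemma fraction_zero: "\<zero>\<^bsub>ring_of_fractions R S\<^esub> = fraction R S \<zero> \<one>"
  and fraction_one: "\<one>\<^bsub>ring_of_fractions R S\<^esub> = fraction R S \<one> \<one>"
  unfolding ring_of_fractions_def by simp_all

lemma cring_ring_of_fractions: "cring (ring_of_fractions R S)"
proof (rule cringI)
  show "abelian_group (ring_of_fractions R S)"
  proof (rule abelian_groupI)
    fix A assume A: "A \<in> carrier (ring_of_fractions R S)"
    then obtain a s where as: "a \<in> carrier R" "s \<in> S" "A = fraction R S a s"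
      by (rule fraction_cases)
    note C = as(1) as(2)[THEN S_carrier]
    have "fraction R S (\<ominus> a \<otimes> s \<oplus> a \<otimes> s) (s \<otimes> s) = fraction R S \<zero> \<one>"
      using as C by (subst fraction_eq) (auto simp: l_minus l_neg intro!: fraction_relI[where u = \<one>])
    then show "\<exists>B\<in>carrier (ring_of_fractions R S).
        B \<oplus>\<^bsub>ring_of_fractions R S\<^esub> A = \<zero>\<^bsub>ring_of_fractions R S\<^esub>"
      using as by (intro bexI[where x = "fraction R S (\<ominus> a) s"]) (simp_all add: fraction_add fraction_zero)
  next
    fix A B D
    assume "A \<in> carrier (ring_of_fractions R S)" "B \<in> carrier (ring_of_fractions R S)"
      "D \<in> carrier (ring_of_fractions R S)"
    then obtain a s b t c w where S: "s \<in> S" "t \<in> S" "w \<in> S"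
      and C: "a \<in> carrier R" "b \<in> carrier R" "c \<in> carrier R"
      and A: "A = fraction R S a s" "B = fraction R S b t" "D = fraction R S c w"
      by (metis fraction_cases)
    note C = C S[THEN S_carrier]
    have "(a \<otimes> t \<oplus> b \<otimes> s) \<otimes> w \<oplus> c \<otimes> (s \<otimes> t) = a \<otimes> (t \<otimes> w) \<oplus> (b \<otimes> w \<oplus> c \<otimes> t) \<otimes> s"
      using C by (simp add: l_distr r_distr a_assoc m_ac)
    then show "A \<oplus>\<^bsub>ring_of_fractions R S\<^esub> B \<oplus>\<^bsub>ring_of_fractions R S\<^esub> D =
        A \<oplus>\<^bsub>ring_of_fractions R S\<^esub> (B \<oplus>\<^bsub>ring_of_fractions R S\<^esub> D)"
      using S C by (simp add: A fraction_add m_assoc)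
    show "A \<oplus>\<^bsub>ring_of_fractions R S\<^esub> B = B \<oplus>\<^bsub>ring_of_fractions R S\<^esub> A"
      using S C by (simp add: A fraction_add a_comm m_comm)
  qed (auto elim!: fraction_cases simp: fraction_add fraction_zero S_carrier)
  show "comm_monoid (ring_of_fractions R S)"
    by (rule comm_monoidI) (auto elim!: fraction_cases simp: fraction_mult fraction_one S_carrier m_ac)
  fix A B D
  assume "A \<in> carrier (ring_of_fractions R S)" "B \<in> carrier (ring_of_fractions R S)"
    "D \<in> carrier (ring_of_fractions R S)"
  then obtain a s b t c w where S: "s \<in> S" "t \<in> S" "w \<in> S"
    and C: "a \<in> carrier R" "b \<in> carrier R" "c \<in> carrier R"
    and A: "A = fraction R S a s" "B = fraction R S b t" "D = fraction R S c w"
    by (metis fraction_cases)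
  note C = C S[THEN S_carrier]
  have "fraction R S ((a \<otimes> t \<oplus> b \<otimes> s) \<otimes> c) (s \<otimes> t \<otimes> w) =
      fraction R S (a \<otimes> c \<otimes> (t \<otimes> w) \<oplus> b \<otimes> c \<otimes> (s \<otimes> w)) (s \<otimes> w \<otimes> (t \<otimes> w))"
    using S C by (subst fraction_eq) (auto simp: l_distr r_distr m_ac intro!: fraction_relI[where u = \<one>])
  then show "(A \<oplus>\<^bsub>ring_of_fractions R S\<^esub> B) \<otimes>\<^bsub>ring_of_fractions R S\<^esub> D =
      A \<otimes>\<^bsub>ring_of_fractions R S\<^esub> D \<oplus>\<^bsub>ring_of_fractions R S\<^esub> B \<otimes>\<^bsub>ring_of_fractions R S\<^esub> D"
    using S C by (simp add: A fraction_add fraction_mult)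
qed

lemma fraction_map_hom: "(\<lambda>a. fraction R S a \<one>) \<in> ring_hom R (ring_of_fractions R S)"
  by (rule ring_hom_memI) (simp_all add: fraction_add fraction_mult fraction_one)

end

lemma (in primeideal) fractions_compl: "fractions R (carrier R - I)"
proof (intro fractions.intro is_cring submonoid.intro)
  show "\<one> \<in> carrier R - I"
    using I_notcarr one_imp_carrier by auto
qed (use I_prime in auto)

lemma (in primeideal) cring_localization_at: "cring (localization_at R I)"
  unfolding localization_at_def by (rule fractions.cring_ring_of_fractions[OF fractions_compl])

lemma (in primeideal) localization_map_hom:
  "localization_map R I \<in> ring_hom R (localization_at R I)"
  using fractions.fraction_map_hom[OF fractions_compl]
  unfolding localization_at_def localization_map_def[abs_def] .

end

theory Submission
  imports Defs "HOL-Algebra.Ring_Divisibility"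
begin

text \<open>Write \<open>O(\<mm>)\<close> for the kernel of the localization map at \<open>\<mm>\<close>. An element \<open>r\<close> lies in
  \<open>O(\<mm>)\<close> exactly when some \<open>s \<notin> \<mm>\<close> kills it (lemma \<open>localization_kernel\<close>), so both inclusions
  are about finding annihilators outside \<open>\<mm>\<close>.

  If \<open>x \<in> I \<subseteq> \<mm>\<close>, then N-purity gives \<open>b \<in> I\<close> with \<open>x\<^sup>k (1 - b)\<^sup>k = 0\<close>. Since \<open>b \<in> \<mm>\<close>, the prime
  ideal \<open>\<mm>\<close> does not contain \<open>(1 - b)\<^sup>k\<close>, so a power of \<open>x\<close> lies in \<open>O(\<mm>)\<close>. This gives
  \<open>\<surd>I \<subseteq> \<surd>O(\<mm>)\<close>.

  Conversely, let \<open>a\<close> lie in \<open>\<surd>O(\<mm>)\<close> for every maximal \<open>\<mm> \<supseteq> I\<close>. Consider the ideal \<open>(I : a\<^sup>\<infinity>)\<close>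
  of all \<open>r\<close> that multiply some power of \<open>a\<close> into \<open>I\<close>. It contains \<open>I\<close>. If it were proper, it
  would lie in some maximal \<open>\<mm>\<close>; but \<open>s a\<^sup>n = 0 \<in> I\<close> for some \<open>n\<close> and some \<open>s \<notin> \<mm>\<close>, and this \<open>s\<close>
  belongs to \<open>(I : a\<^sup>\<infinity>)\<close>, a contradiction. So \<open>1 \<in> (I : a\<^sup>\<infinity>)\<close>, which says that \<open>a \<in> \<surd>I\<close>.\<close>

lemma (in ideal) one_notin_if_proper: "I \<noteq> carrier R \<Longrightarrow> \<one> \<notin> I"
  using one_imp_carrier by blast

text \<open>Properness survives unions of chains because it means that \<open>\<one>\<close> is missing; this is what
  lets Zorn's lemma apply.\<close>

lemma (in ring) proper_ideal_subset_maximalideal: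
  assumes "ideal J R" and "J \<noteq> carrier R"
  obtains M where "maximalideal M R" and "J \<subseteq> M"
proof -
  let ?A = "{K. ideal K R \<and> J \<subseteq> K \<and> \<one> \<notin> K}"
  have "\<exists>M\<in>?A. \<forall>X\<in>?A. M \<subseteq> X \<longrightarrow> X = M"
  proof (rule subset_Zorn_nonempty)
    show "?A \<noteq> {}"
      using assms ideal.one_notin_if_proper by blast
    fix C assume C: "C \<noteq> {}" "subset.chain ?A C"
    then have "subset.chain {K. ideal K R} C"
      by (auto simp: pred_on.chain_def)
    from chain_Union_is_ideal[OF this] have "ideal (\<Union>C) R"
      using C(1) by simp
    moreover have "J \<subseteq> \<Union>C"
      using C unfolding pred_on.chain_def by blast
    moreover have "\<one> \<notin> \<Union>C"
      using C by (auto simp: pred_on.chain_def)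
    ultimately show "\<Union>C \<in> ?A"
      by simp
  qed
  then obtain M where "M \<in> ?A" and max: "\<forall>X\<in>?A. M \<subseteq> X \<longrightarrow> X = M" ..
  then have M: "ideal M R" "J \<subseteq> M" "\<one> \<notin> M"
    by simp_all
  have "maximalideal M R"
  proof (rule maximalidealI[OF M(1)])
    show "carrier R \<noteq> M"
      using M(3) by blast
    fix X assume X: "ideal X R" "M \<subseteq> X"
    show "X = M \<or> X = carrier R"
    proof (cases "X = carrier R")
      case False
      then have "X \<in> ?A"
        using X M(2) ideal.one_notin_if_proper by auto
      then show ?thesis
        using max X(2) by simp
    qed simp
  qed
  then show thesis
    using M(2) that by blast
qed

text \<open>By definition \<open>r/1 = 0/1\<close> holds when some \<open>s \<notin> I\<close> satisfies \<open>s (r 1 - 0 1) = 0\<close>.\<close>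

lemma (in primeideal) localization_kernel:
  "a_kernel R (localization_at R I) (localization_map R I) =
     {r \<in> carrier R. \<exists>s \<in> carrier R - I. s \<otimes> r = \<zero>}"
proof -
  interpret fractions R "carrier R - I"
    by (rule fractions_compl)
  have one: "\<one> \<in> carrier R - I"
    using I_notcarr one_imp_carrier by auto
  have "localization_map R I r = \<zero>\<^bsub>localization_at R I\<^esub> \<longleftrightarrow>
      (\<exists>s \<in> carrier R - I. s \<otimes> r = \<zero>)" if "r \<in> carrier R" for r
    using that one
    by (simp add: localization_map_def localization_at_def fraction_zero fraction_eq
        fraction_rel_iff)
  then show ?thesis
    by (auto simp: a_kernel_def')
qed

lemma (in primeideal) pow_mem_imp_mem:
  fixes n :: nat
  assumes "x \<in> carrier R" and "x [^] n \<in> I"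
  shows "x \<in> I"
  using assms(2)
proof (induction n)
  case 0
  then show ?case
    using I_notcarr one_imp_carrier by simp
next
  case (Suc n)
  then show ?case
    using I_prime[of "x [^] n" x] assms(1) by auto
qed

text \<open>Known as \<open>(I : a\<^sup>\<infinity>)\<close>.\<close>

definition saturation :: "('a, 'b) ring_scheme \<Rightarrow> 'a set \<Rightarrow> 'a \<Rightarrow> 'a set" where
  "saturation R I a = {r \<in> carrier R. \<exists>n::nat. r \<otimes>\<^bsub>R\<^esub> a [^]\<^bsub>R\<^esub> n \<in> I}"

lemma (in cring) ideal_saturation:
  assumes "ideal I R" and a: "a \<in> carrier R"
  shows "ideal (saturation R I a) R"
proof -
  interpret I: ideal I R by fact
  have add: "x \<oplus> y \<in> saturation R I a"
    if xy: "x \<in> saturation R I a" "y \<in> saturation R I a" for x y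
  proof -
    obtain m n :: nat where mn: "x \<otimes> a [^] m \<in> I" "y \<otimes> a [^] n \<in> I"
      and C: "x \<in> carrier R" "y \<in> carrier R"
      using xy by (auto simp: saturation_def)
    have "(x \<oplus> y) \<otimes> a [^] (m + n) = (x \<otimes> a [^] m) \<otimes> a [^] n \<oplus> (y \<otimes> a [^] n) \<otimes> a [^] m"
      using C a by (simp add: l_distr r_distr m_ac flip: nat_pow_mult)
    also have "\<dots> \<in> I"
      using I.I_r_closed[OF mn(1)] I.I_r_closed[OF mn(2)] a
      by (simp add: additive_subgroup.a_closed[OF I.is_additive_subgroup])
    finally show ?thesis
      using C unfolding saturation_def by blast
  qed
  have mult: "r \<otimes> x \<in> saturation R I a" if "x \<in> saturation R I a" "r \<in> carrier R" for x r
    using that a I.I_l_closed by (fastforce simp: saturation_def m_assoc)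
  show ?thesis
  proof (rule idealI[OF ring_axioms])
    show "subgroup (saturation R I a) (add_monoid R)"
    proof (rule add.subgroupI)
      show "saturation R I a \<subseteq> carrier R"
        by (auto simp: saturation_def)
      have "\<zero> \<in> saturation R I a"
        using a by (auto simp: saturation_def)
      then show "saturation R I a \<noteq> {}"
        by blast
      show "\<ominus> x \<in> saturation R I a" if "x \<in> saturation R I a" for x
        using mult[OF that, of "\<ominus> \<one>"] that by (simp add: saturation_def l_minus)
    qed (rule add)
    show "r \<otimes> x \<in> saturation R I a" if "x \<in> saturation R I a" "r \<in> carrier R" for x r
      using that by (rule mult)
    then show "x \<otimes> r \<in> saturation R I a" if "x \<in> saturation R I a" "r \<in> carrier R" for x r
      using that m_comm[of x r] by (simp add: saturation_def)
  qed
qed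

lemma (in ideal) subset_saturation: "a \<in> carrier R \<Longrightarrow> I \<subseteq> saturation R I a"
  unfolding saturation_def using a_subset by (auto intro!: exI[where x = 0])

lemma (in ideal) radical_if_saturation_eq_carrier:
  assumes a: "a \<in> carrier R" and "saturation R I a = carrier R"
  shows "a \<in> ideal_radical R I"
proof -
  obtain n :: nat where "\<one> \<otimes> a [^] n \<in> I"
    using assms(2) by (auto simp: saturation_def)
  then have "a [^] n \<in> I"
    using a by simp
  \<comment> \<open>The radical asks for a positive exponent, but \<open>n\<close> may be \<open>0\<close>.\<close>
  then have "a [^] Suc n \<in> I"
    using a I_r_closed by simp
  then show ?thesis
    using a unfolding ideal_radical_def by blast
qed

text \<open>N-purity makes \<open>x (\<one> \<ominus> b)\<close> nilpotent for each \<open>x \<in> J\<close> and a suitable \<open>b \<in> J\<close>. As \<open>b \<in> I\<close>,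
  the element \<open>\<one> \<ominus> b\<close> is \<open>\<one>\<close> modulo the prime ideal \<open>I\<close>, so its powers stay outside \<open>I\<close> and
  serve as the annihilators that the kernel asks for.\<close>

lemma (in primeideal) N_pure_radical_subset_radical_kernel:
  assumes J: "N_pure_ideal R J" "J \<subseteq> I"
  shows "ideal_radical R J \<subseteq>
    ideal_radical R (a_kernel R (localization_at R I) (localization_map R I))"
proof
  fix a assume "a \<in> ideal_radical R J"
  then obtain n :: nat where a: "a \<in> carrier R" and n: "0 < n" "a [^] n \<in> J"
    by (auto simp: ideal_radical_def)
  obtain b where b: "b \<in> J" "a [^] n \<otimes> (\<one> \<ominus> b) \<in> nilradical R"
    using J(1) n(2) unfolding N_pure_ideal_def by blast
  then obtain k :: nat where k: "0 < k" "(a [^] n \<otimes> (\<one> \<ominus> b)) [^] k = \<zero>"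
    by (auto simp: nilradical_def ideal_radical_def)
  have bI: "b \<in> I"
    using b(1) J(2) by blast
  then have bC: "b \<in> carrier R"
    using a_subset by blast
  have "\<one> \<ominus> b \<notin> I"
  proof
    assume "\<one> \<ominus> b \<in> I"
    then have "(\<one> \<ominus> b) \<oplus> b \<in> I"
      using bI by (rule additive_subgroup.a_closed[OF is_additive_subgroup])
    also have "(\<one> \<ominus> b) \<oplus> b = \<one>"
      using bC by (simp add: a_minus_def a_assoc l_neg)
    finally show False
      using I_notcarr one_imp_carrier by blast
  qed
  then have "(\<one> \<ominus> b) [^] k \<in> carrier R - I"
    using bC pow_mem_imp_mem[of "\<one> \<ominus> b" k] by auto
  moreover have "(\<one> \<ominus> b) [^] k \<otimes> a [^] (n * k) = \<zero>"
    using k(2) a bC by (simp add: nat_pow_distrib nat_pow_pow m_comm)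
  ultimately have "a [^] (n * k) \<in>
      a_kernel R (localization_at R I) (localization_map R I)"
    using a unfolding localization_kernel by blast
  then show "a \<in> ideal_radical R (a_kernel R (localization_at R I) (localization_map R I))"
    using a n(1) k(1) unfolding ideal_radical_def by (auto intro!: exI[where x = "n * k"])
qed

text \<open>An annihilator \<open>s \<notin> M\<close> of a power of \<open>a\<close> always belongs to the saturation of \<open>I\<close> by \<open>a\<close>,
  because \<open>\<zero> \<in> I\<close>. Hence no maximal ideal over \<open>I\<close> can contain the saturation.\<close>

lemma (in cring) radical_if_radical_kernel_all_maximal:
  assumes "ideal I R" and a: "a \<in> carrier R"
    and ker: "\<And>M. \<lbrakk>maximalideal M R; I \<subseteq> M\<rbrakk> \<Longrightarrow>
      a \<in> ideal_radical R (a_kernel R (localization_at R M) (localization_map R M))"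
  shows "a \<in> ideal_radical R I"
proof -
  interpret I: ideal I R by fact
  have "saturation R I a = carrier R"
  proof (rule ccontr)
    assume "saturation R I a \<noteq> carrier R"
    then obtain M where M: "maximalideal M R" "saturation R I a \<subseteq> M"
      using proper_ideal_subset_maximalideal ideal_saturation[OF assms(1) a] by blast
    interpret M: primeideal M R
      using M(1) by (rule maximalideal_prime)
    have "a \<in> ideal_radical R (a_kernel R (localization_at R M) (localization_map R M))"
      using M I.subset_saturation[OF a] by (intro ker) auto
    then obtain n :: nat and s where s: "s \<in> carrier R" "s \<notin> M" "s \<otimes> a [^] n = \<zero>"
      unfolding ideal_radical_def M.localization_kernel by auto
    then have "s \<otimes> a [^] n \<in> I"
      by simp
    then have "s \<in> saturation R I a"
      using s(1) unfolding saturation_def by blast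
    then show False
      using s(2) M(2) by blast
  qed
  then show ?thesis
    by (rule I.radical_if_saturation_eq_carrier[OF a])
qed

theorem proposition3p1:
  fixes R (structure)
  assumes "cring R" and "N_pure_ideal R I"
  shows "ideal_radical R I =
    carrier R \<inter>
      (\<Inter>\<mm> \<in> V_ideal R I \<inter> Max_spec R.
        ideal_radical R (a_kernel R (localization_at R \<mm>) (localization_map R \<mm>)))"
proof -
  interpret cring R by fact
  have I: "ideal I R"
    using assms(2) by (simp add: N_pure_ideal_def)
  show ?thesis
  proof (rule equalityI)
    have "ideal_radical R I \<subseteq>
        ideal_radical R (a_kernel R (localization_at R \<mm>) (localization_map R \<mm>))"
      if "\<mm> \<in> V_ideal R I" for \<mm>
      using that primeideal.N_pure_radical_subset_radical_kernel[OF _ assms(2)]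
      by (simp add: V_ideal_def)
    moreover have "ideal_radical R I \<subseteq> carrier R"
      by (auto simp: ideal_radical_def)
    ultimately show "ideal_radical R I \<subseteq> carrier R \<inter>
        (\<Inter>\<mm> \<in> V_ideal R I \<inter> Max_spec R.
          ideal_radical R (a_kernel R (localization_at R \<mm>) (localization_map R \<mm>)))"
      by blast
  next
    show "carrier R \<inter> (\<Inter>\<mm> \<in> V_ideal R I \<inter> Max_spec R.
        ideal_radical R (a_kernel R (localization_at R \<mm>) (localization_map R \<mm>)))
      \<subseteq> ideal_radical R I"
    proof
      fix a assume a: "a \<in> carrier R \<inter> (\<Inter>\<mm> \<in> V_ideal R I \<inter> Max_spec R.
          ideal_radical R (a_kernel R (localization_at R \<mm>) (localization_map R \<mm>)))"
      show "a \<in> ideal_radical R I"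
      proof (rule radical_if_radical_kernel_all_maximal[OF I])
        show "a \<in> carrier R"
          using a by blast
        fix \<mm> assume "maximalideal \<mm> R" "I \<subseteq> \<mm>"
        then have "\<mm> \<in> V_ideal R I \<inter> Max_spec R"
          by (simp add: V_ideal_def Max_spec_def maximalideal_prime)
        then show "a \<in> ideal_radical R
            (a_kernel R (localization_at R \<mm>) (localization_map R \<mm>))"
          using a by blast
      qed
    qed
  qed
qed

end
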